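(* For $a>0$ let $\mathbb{H}_1^a$ be the unit ball of the RKHS of the centered Gaussian process $W^a=(W_t^a:0\le t\le1)$ with covariance kernel $G_a(t,t')=\exp\{-4a^2\sin^2(\pi t-\pi t')\}$. There is a universal constant $c$ such that if $a\le b$, then $\sqrt a\,\mathbb{H}_1^a\subset\sqrt{cb}\,\mathbb{H}_1^b$.
   Context: RKHS means reproducing kernel Hilbert space. Universal means that $c>0$ does not depend on $a$ and $b$; here $0<a\le b$. *)

theory Defs
  imports "HOL-Probability.Probability" "HOL-Library.Poly_Mapping"
begin

text \<open>
  The RKHS of a positive semidefinite kernel \<open>K\<close> on a set \<open>T\<close> is the completion of the linear
  span of the functions \<open>K s\<close>, \<open>s \<in> T\<close>, under the inner product with
  \<open>\<langle>K s, K t\<rangle> = K s t\<close>. By the reproducing property a Cauchy sequence in the span converges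
  pointwise on \<open>T\<close>, so the completion is realised as a space of functions on \<open>T\<close>. A finitely
  supported \<open>c\<close> stands for the combination of the \<open>K s\<close> with coefficients \<open>c s\<close>; distinct \<open>c\<close>
  may represent the same function.
\<close>

definition kernel_comb :: "('a \<Rightarrow> 'a \<Rightarrow> real) \<Rightarrow> ('a \<Rightarrow>\<^sub>0 real) \<Rightarrow> 'a \<Rightarrow> real" where
  "kernel_comb K c t = (\<Sum>s\<in>Poly_Mapping.keys c. Poly_Mapping.lookup c s * K s t)"

definition kernel_inner :: "('a \<Rightarrow> 'a \<Rightarrow> real) \<Rightarrow> ('a \<Rightarrow>\<^sub>0 real) \<Rightarrow> ('a \<Rightarrow>\<^sub>0 real) \<Rightarrow> real" where
  "kernel_inner K c d =
     (\<Sum>s\<in>Poly_Mapping.keys c. \<Sum>t\<in>Poly_Mapping.keys d.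
        Poly_Mapping.lookup c s * Poly_Mapping.lookup d t * K s t)"

definition kernel_norm :: "('a \<Rightarrow> 'a \<Rightarrow> real) \<Rightarrow> ('a \<Rightarrow>\<^sub>0 real) \<Rightarrow> real" where
  "kernel_norm K c = sqrt (kernel_inner K c c)"

text \<open>Functions on \<open>T\<close> are represented by functions on the whole type vanishing outside \<open>T\<close>.\<close>

definition rkhs_limit ::
    "'a set \<Rightarrow> ('a \<Rightarrow> 'a \<Rightarrow> real) \<Rightarrow> (nat \<Rightarrow> 'a \<Rightarrow>\<^sub>0 real) \<Rightarrow> ('a \<Rightarrow> real) \<Rightarrow> bool" where
  "rkhs_limit T K c f \<longleftrightarrow>
     (\<forall>n. Poly_Mapping.keys (c n) \<subseteq> T) \<and>
     (\<forall>e>0. \<exists>N. \<forall>m\<ge>N. \<forall>n\<ge>N. kernel_norm K (c m - c n) < e) \<and>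
     (\<forall>t\<in>T. (\<lambda>n. kernel_comb K (c n) t) \<longlonglongrightarrow> f t) \<and>
     (\<forall>t. t \<notin> T \<longrightarrow> f t = 0)"

definition rkhs :: "'a set \<Rightarrow> ('a \<Rightarrow> 'a \<Rightarrow> real) \<Rightarrow> ('a \<Rightarrow> real) set" where
  "rkhs T K = {f. \<exists>c. rkhs_limit T K c f}"

text \<open>For positive semidefinite \<open>K\<close> the limit below exists and does not depend on the choice of \<open>c\<close>.\<close>

definition rkhs_norm :: "'a set \<Rightarrow> ('a \<Rightarrow> 'a \<Rightarrow> real) \<Rightarrow> ('a \<Rightarrow> real) \<Rightarrow> real" where
  "rkhs_norm T K f =
     (THE r. \<exists>c. rkhs_limit T K c f \<and> (\<lambda>n. kernel_norm K (c n)) \<longlonglongrightarrow> r)"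

definition rkhs_unit_ball :: "'a set \<Rightarrow> ('a \<Rightarrow> 'a \<Rightarrow> real) \<Rightarrow> ('a \<Rightarrow> real) set" where
  "rkhs_unit_ball T K = {f \<in> rkhs T K. rkhs_norm T K f \<le> 1}"

text \<open>Degenerate (almost surely constant) variables count as Gaussian.\<close>

definition gaussian_variable :: "'w measure \<Rightarrow> ('w \<Rightarrow> real) \<Rightarrow> bool" where
  "gaussian_variable M X \<longleftrightarrow> X \<in> borel_measurable M \<and>
     ((\<exists>\<mu> \<sigma>. \<sigma> > 0 \<and> distributed M lborel X (\<lambda>x. ennreal (normal_density \<mu> \<sigma> x))) \<or>
      (\<exists>\<mu>. AE \<omega> in M. X \<omega> = \<mu>))"

text \<open>The covariance function of a centered process.\<close>

definition process_cov :: "'w measure \<Rightarrow> ('a \<Rightarrow> 'w \<Rightarrow> real) \<Rightarrow> 'a \<Rightarrow> 'a \<Rightarrow> real" where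
  "process_cov M W s t = (\<integral>\<omega>. W s \<omega> * W t \<omega> \<partial>M)"

definition centered_gaussian_process ::
    "'w measure \<Rightarrow> 'a set \<Rightarrow> ('a \<Rightarrow> 'w \<Rightarrow> real) \<Rightarrow> ('a \<Rightarrow> 'a \<Rightarrow> real) \<Rightarrow> bool" where
  "centered_gaussian_process M T W K \<longleftrightarrow>
     prob_space M \<and>
     (\<forall>c. Poly_Mapping.keys c \<subseteq> T \<longrightarrow>
        gaussian_variable M
          (\<lambda>\<omega>. \<Sum>t\<in>Poly_Mapping.keys c. Poly_Mapping.lookup c t * W t \<omega>)) \<and>
     (\<forall>t\<in>T. (\<integral>\<omega>. W t \<omega> \<partial>M) = 0) \<and>
     (\<forall>s\<in>T. \<forall>t\<in>T. process_cov M W s t = K s t)"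

definition process_rkhs_unit_ball :: "'w measure \<Rightarrow> 'a set \<Rightarrow> ('a \<Rightarrow> 'w \<Rightarrow> real) \<Rightarrow> ('a \<Rightarrow> real) set" where
  "process_rkhs_unit_ball M T W = rkhs_unit_ball T (process_cov M W)"

definition G :: "real \<Rightarrow> real \<Rightarrow> real \<Rightarrow> real" where
  "G a t t' = exp (- 4 * a\<^sup>2 * (sin (pi * t - pi * t'))\<^sup>2)"

definition scale_set :: "real \<Rightarrow> ('a \<Rightarrow> real) set \<Rightarrow> ('a \<Rightarrow> real) set" where
  "scale_set r B = (\<lambda>f t. r * f t) ` B"

end

theory Submission imports Defs begin

text \<open>
  Two facts carry the proof. The first, \<open>rkhs_unit_ball_iff\<close>, describes the unit ball of an RKHS
  without completions: a function \<open>f\<close> vanishing outside \<open>T\<close> belongs to it iff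
  \<open>(\<Sum>s. d s * f s)\<^sup>2 \<le> (\<Sum>s t. d s * d t * K s t)\<close> for all finitely supported \<open>d\<close> on \<open>T\<close>.
  Consequently \<open>\<surd>a H\<^sub>K \<subseteq> \<surd>c H\<^sub>L\<close> for the unit balls \<open>H\<^sub>K\<close>, \<open>H\<^sub>L\<close> as soon as \<open>c L - a K\<close> is positive
  semidefinite (\<open>scaled_rkhs_unit_ball_mono\<close>). The nontrivial direction of the description is the
  Riesz representation theorem, obtained by minimizing the quadratic functional
  \<open>\<langle>d, d\<rangle> - 2 (\<Sum>s. d s * f s)\<close>: a minimizing sequence is Cauchy and converges pointwise to \<open>f\<close>.

  The second fact is a comparison of spectra. The kernel \<open>G a\<close> depends only on \<open>s - t\<close>, is periodic,
  and equals \<open>exp (-x) * exp (x cos (2 \<pi> (s - t)))\<close> with \<open>x = 2 a\<^sup>2\<close>; its Fourier coefficients are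
  \<open>exp (-x) I\<^sub>k x\<close> with the modified Bessel functions \<open>I\<^sub>k\<close> (\<open>G_fourier\<close>). Positive semidefiniteness of
  \<open>c b G b - a G a\<close> thus reduces to bounding \<open>\<surd>x exp (-x) I\<^sub>k x\<close> by a constant multiple of its
  value at any larger \<open>x\<close>, uniformly in \<open>k\<close> (\<open>scaled_spectral_weight_le\<close>).

  For \<open>k \<ge> 1\<close> this function is nondecreasing: \<open>w = \<surd>x I\<^sub>k x\<close> solves \<open>w'' = (1 + (k\<^sup>2 - 1/4) / x\<^sup>2) w\<close>,
  so that \<open>w'' \<ge> w\<close>, hence \<open>exp x (w' - w)\<close> is nondecreasing and vanishes at \<open>0\<close>, hence
  \<open>exp (-x) w\<close> is nondecreasing. For \<open>k = 0\<close> monotonicity fails. For large arguments \<open>I\<^sub>0\<close> is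
  comparable with \<open>I\<^sub>1\<close>, by \<open>I\<^sub>1 \<le> I\<^sub>0 = I\<^sub>2 + (2 / x) I\<^sub>1 \<le> (1 + 2 / x) I\<^sub>1\<close>, and for bounded ones
  the factor \<open>exp (-x)\<close> is bounded below while \<open>\<surd>x I\<^sub>0 x\<close> increases.
\<close>

section \<open>Reproducing kernel Hilbert spaces\<close>

definition pairing :: "('a \<Rightarrow>\<^sub>0 real) \<Rightarrow> ('a \<Rightarrow> real) \<Rightarrow> real" where
  "pairing c f = (\<Sum>s\<in>Poly_Mapping.keys c. Poly_Mapping.lookup c s * f s)"

definition smult_pm :: "real \<Rightarrow> ('a \<Rightarrow>\<^sub>0 real) \<Rightarrow> ('a \<Rightarrow>\<^sub>0 real)" where
  "smult_pm r c = Poly_Mapping.map (\<lambda>x. r * x) c"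

lemma lookup_smult_pm [simp]: "Poly_Mapping.lookup (smult_pm r c) s = r * Poly_Mapping.lookup c s"
  by (simp add: smult_pm_def Poly_Mapping.map.rep_eq when_def)

lemma keys_smult_pm: "Poly_Mapping.keys (smult_pm r c) \<subseteq> Poly_Mapping.keys c"
  by (auto simp: in_keys_iff)

lemma pairing_superset:
  assumes "finite S" "Poly_Mapping.keys c \<subseteq> S"
  shows "pairing c f = (\<Sum>s\<in>S. Poly_Mapping.lookup c s * f s)"
  unfolding pairing_def using assms
  by (intro sum.mono_neutral_left) (auto simp: in_keys_iff)

lemma pairing_add: "pairing (c + d) f = pairing c f + pairing d f"
proof -
  let ?S = "Poly_Mapping.keys c \<union> Poly_Mapping.keys d"
  have "pairing (c + d) f = (\<Sum>s\<in>?S. Poly_Mapping.lookup (c + d) s * f s)"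
    using Poly_Mapping.keys_add[of c d] by (intro pairing_superset) auto
  also have "\<dots> = (\<Sum>s\<in>?S. Poly_Mapping.lookup c s * f s) + (\<Sum>s\<in>?S. Poly_Mapping.lookup d s * f s)"
    by (simp add: lookup_add algebra_simps sum.distrib)
  also have "\<dots> = pairing c f + pairing d f"
    by (simp add: pairing_superset[of ?S c] pairing_superset[of ?S d])
  finally show ?thesis .
qed

lemma pairing_smult: "pairing (smult_pm r c) f = r * pairing c f"
  by (subst pairing_superset[OF _ keys_smult_pm]) (auto simp: pairing_def sum_distrib_left mult_ac)

lemma pairing_diff: "pairing (c - d) f = pairing c f - pairing d f"
  using pairing_add[of "c - d" d f] by simp

lemma pairing_add_right: "pairing c (\<lambda>s. f s + g s) = pairing c f + pairing c g"
  by (simp add: pairing_def algebra_simps sum.distrib)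

lemma pairing_diff_right: "pairing c (\<lambda>s. f s - g s) = pairing c f - pairing c g"
  by (simp add: pairing_def algebra_simps sum_subtractf)

lemma pairing_scale_right: "pairing c (\<lambda>s. r * f s) = r * pairing c f"
  by (simp add: pairing_def sum_distrib_left mult_ac)

lemma pairing_single: "pairing (Poly_Mapping.single t 1) f = f t"
  by (subst pairing_superset[of "{t}"]) auto

lemma pairing_cong:
  assumes "Poly_Mapping.keys c \<subseteq> T" "\<And>s. s \<in> T \<Longrightarrow> f s = g s"
  shows "pairing c f = pairing c g"
  unfolding pairing_def using assms by (intro sum.cong) auto

lemma pairing_tendsto:
  assumes "Poly_Mapping.keys c \<subseteq> T" "\<And>t. t \<in> T \<Longrightarrow> (\<lambda>n. f n t) \<longlonglongrightarrow> g t"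
  shows "(\<lambda>n. pairing c (f n)) \<longlonglongrightarrow> pairing c g"
  unfolding pairing_def using assms by (intro tendsto_sum tendsto_mult tendsto_const) auto

lemma kernel_comb_pairing: "kernel_comb K c t = pairing c (\<lambda>s. K s t)"
  by (simp add: kernel_comb_def pairing_def)

lemma kernel_inner_pairing: "kernel_inner K c d = pairing c (\<lambda>s. pairing d (K s))"
  by (simp add: kernel_inner_def pairing_def sum_distrib_left mult_ac)

lemma kernel_inner_eq_pairing_comb: "kernel_inner K c d = pairing d (kernel_comb K c)"
  unfolding kernel_inner_def pairing_def kernel_comb_def
  by (subst sum.swap) (simp add: sum_distrib_left mult_ac)

lemmas kernel_inner_linear =
  kernel_inner_pairing pairing_add pairing_diff pairing_smult
  pairing_add_right pairing_diff_right pairing_scale_right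

definition psd_kernel :: "'a set \<Rightarrow> ('a \<Rightarrow> 'a \<Rightarrow> real) \<Rightarrow> bool" where
  "psd_kernel T K \<longleftrightarrow> (\<forall>s\<in>T. \<forall>t\<in>T. K s t = K t s) \<and>
     (\<forall>c. Poly_Mapping.keys c \<subseteq> T \<longrightarrow> 0 \<le> kernel_inner K c c)"

lemma kernel_inner_commute:
  assumes "psd_kernel T K" "Poly_Mapping.keys c \<subseteq> T" "Poly_Mapping.keys d \<subseteq> T"
  shows "kernel_inner K c d = kernel_inner K d c"
proof -
  have "kernel_inner K c d = pairing d (kernel_comb K c)" by (rule kernel_inner_eq_pairing_comb)
  also have "\<dots> = pairing d (\<lambda>s. pairing c (K s))"
    unfolding kernel_comb_pairing using assms
    by (intro pairing_cong[of _ T]) (auto simp: psd_kernel_def)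
  finally show ?thesis by (simp add: kernel_inner_pairing)
qed

lemma keys_diff_subset:
  fixes c d :: "'a \<Rightarrow>\<^sub>0 real"
  assumes "Poly_Mapping.keys c \<subseteq> T" "Poly_Mapping.keys d \<subseteq> T"
  shows "Poly_Mapping.keys (c - d) \<subseteq> T"
  using keys_diff[of c d] assms by blast

lemma keys_add_smult_subset:
  assumes "Poly_Mapping.keys c \<subseteq> T" "Poly_Mapping.keys d \<subseteq> T"
  shows "Poly_Mapping.keys (c + smult_pm r d) \<subseteq> T"
  using Poly_Mapping.keys_add[of c "smult_pm r d"] keys_smult_pm[of r d] assms by blast

lemma kernel_norm_square:
  assumes "psd_kernel T K" "Poly_Mapping.keys c \<subseteq> T"
  shows "(kernel_norm K c)\<^sup>2 = kernel_inner K c c"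
  using assms by (simp add: psd_kernel_def kernel_norm_def)

lemma kernel_norm_nonneg:
  assumes "psd_kernel T K" "Poly_Mapping.keys c \<subseteq> T"
  shows "0 \<le> kernel_norm K c"
  using assms by (simp add: psd_kernel_def kernel_norm_def)

text \<open>
  Applied twice: to the squared norm along a line, where it yields the Cauchy--Schwarz inequality,
  and to a quadratic functional near its infimum, where it says that the derivative at an almost
  minimal point is almost zero.
\<close>

lemma nonneg_quadratic_discriminant:
  fixes A B C :: real
  assumes C: "0 \<le> C" and quadratic: "\<And>r. 0 \<le> A + 2 * r * B + r\<^sup>2 * C"
  shows "B\<^sup>2 \<le> A * C"
proof (cases "C = 0")
  case True
  have "B = 0"
  proof (rule ccontr)
    assume "B \<noteq> 0"
    then show False
      using quadratic[of "- (A + 1) / (2 * B)"] True by (simp add: field_simps)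
  qed
  with True show ?thesis by simp
next
  case False
  with C have "C > 0" by simp
  have "0 \<le> A - B\<^sup>2 / C"
    using quadratic[of "- B / C"] \<open>C > 0\<close> by (simp add: field_simps power2_eq_square)
  with \<open>C > 0\<close> show ?thesis by (simp add: field_simps)
qed

lemma kernel_inner_line:
  assumes K: "psd_kernel T K" and c: "Poly_Mapping.keys c \<subseteq> T" and d: "Poly_Mapping.keys d \<subseteq> T"
  shows "kernel_inner K (c + smult_pm r d) (c + smult_pm r d) =
    kernel_inner K c c + 2 * r * kernel_inner K c d + r\<^sup>2 * kernel_inner K d d"
proof -
  have "kernel_inner K (c + smult_pm r d) (c + smult_pm r d) =
      kernel_inner K c c + r * kernel_inner K c d + r * kernel_inner K d c + r\<^sup>2 * kernel_inner K d d"
    by (simp add: kernel_inner_linear power2_eq_square algebra_simps)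
  then show ?thesis using kernel_inner_commute[OF K c d] by simp
qed

lemma kernel_Cauchy_Schwarz:
  assumes K: "psd_kernel T K" and c: "Poly_Mapping.keys c \<subseteq> T" and d: "Poly_Mapping.keys d \<subseteq> T"
  shows "\<bar>kernel_inner K c d\<bar> \<le> kernel_norm K c * kernel_norm K d"
proof -
  have "(kernel_inner K c d)\<^sup>2 \<le> kernel_inner K c c * kernel_inner K d d"
  proof (rule nonneg_quadratic_discriminant)
    show "0 \<le> kernel_inner K d d" using K d by (simp add: psd_kernel_def)
    show "0 \<le> kernel_inner K c c + 2 * r * kernel_inner K c d + r\<^sup>2 * kernel_inner K d d" for r
      using K keys_add_smult_subset[OF c d, of r] kernel_inner_line[OF K c d, of r]
      by (metis psd_kernel_def)
  qed
  also have "\<dots> = (kernel_norm K c * kernel_norm K d)\<^sup>2"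
    by (simp add: power_mult_distrib kernel_norm_square[OF K] c d)
  finally show ?thesis
    using kernel_norm_nonneg[OF K c] kernel_norm_nonneg[OF K d] by (simp add: abs_le_square_iff[symmetric])
qed

lemma kernel_norm_diff_lipschitz:
  assumes K: "psd_kernel T K" and c: "Poly_Mapping.keys c \<subseteq> T" and d: "Poly_Mapping.keys d \<subseteq> T"
  shows "\<bar>kernel_norm K c - kernel_norm K d\<bar> \<le> kernel_norm K (c - d)"
proof -
  have "(kernel_norm K c - kernel_norm K d)\<^sup>2
      = kernel_inner K c c + kernel_inner K d d - 2 * (kernel_norm K c * kernel_norm K d)"
    by (simp add: power2_diff kernel_norm_square[OF K] c d)
  also have "\<dots> \<le> kernel_inner K c c + kernel_inner K d d - 2 * kernel_inner K c d"
    using kernel_Cauchy_Schwarz[OF K c d] by simp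
  also have "\<dots> = kernel_inner K (c - d) (c - d)"
    using kernel_inner_commute[OF K c d] by (simp add: kernel_inner_linear)
  also have "\<dots> = (kernel_norm K (c - d))\<^sup>2"
    by (simp add: kernel_norm_square[OF K] keys_diff_subset c d)
  finally show ?thesis
    using kernel_norm_nonneg[OF K keys_diff_subset[OF c d]] by (simp add: abs_le_square_iff[symmetric])
qed

lemma rkhs_limit_norm_convergent:
  assumes K: "psd_kernel T K" and lim: "rkhs_limit T K c f"
  obtains r where "(\<lambda>n. kernel_norm K (c n)) \<longlonglongrightarrow> r"
proof -
  have keys: "\<And>n. Poly_Mapping.keys (c n) \<subseteq> T" using lim by (simp add: rkhs_limit_def)
  have "Cauchy (\<lambda>n. kernel_norm K (c n))"
  proof (rule metric_CauchyI)
    fix e :: real assume "e > 0"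
    then obtain N where "\<And>m n. m \<ge> N \<Longrightarrow> n \<ge> N \<Longrightarrow> kernel_norm K (c m - c n) < e"
      using lim unfolding rkhs_limit_def by blast
    then show "\<exists>N. \<forall>m\<ge>N. \<forall>n\<ge>N. dist (kernel_norm K (c m)) (kernel_norm K (c n)) < e"
      using kernel_norm_diff_lipschitz[OF K keys keys]
      by (metis dist_real_def order_le_less_trans)
  qed
  then show ?thesis using that by (auto simp: Cauchy_convergent_iff convergent_def)
qed

lemma rkhs_limit_inner_tendsto:
  assumes lim: "rkhs_limit T K c f" and d: "Poly_Mapping.keys d \<subseteq> T"
  shows "(\<lambda>n. kernel_inner K (c n) d) \<longlonglongrightarrow> pairing d f"
  unfolding kernel_inner_eq_pairing_comb
  using lim by (intro pairing_tendsto[OF d]) (auto simp: rkhs_limit_def)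

lemma rkhs_limit_pairing_bound:
  assumes K: "psd_kernel T K" and lim: "rkhs_limit T K c f"
    and r: "(\<lambda>n. kernel_norm K (c n)) \<longlonglongrightarrow> r" and d: "Poly_Mapping.keys d \<subseteq> T"
  shows "\<bar>pairing d f\<bar> \<le> r * kernel_norm K d"
proof (rule LIMSEQ_le)
  show "(\<lambda>n. \<bar>kernel_inner K (c n) d\<bar>) \<longlonglongrightarrow> \<bar>pairing d f\<bar>"
    by (intro tendsto_rabs rkhs_limit_inner_tendsto[OF lim d])
  show "(\<lambda>n. kernel_norm K (c n) * kernel_norm K d) \<longlonglongrightarrow> r * kernel_norm K d"
    by (intro tendsto_mult r tendsto_const)
  show "\<exists>N. \<forall>n\<ge>N. \<bar>kernel_inner K (c n) d\<bar> \<le> kernel_norm K (c n) * kernel_norm K d"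
    using lim d kernel_Cauchy_Schwarz[OF K] by (auto simp: rkhs_limit_def)
qed

text \<open>
  The pairing of \<open>f\<close> with \<open>c n\<close> and the square of the norm of \<open>c n\<close> have the same limit, the
  squared norm of \<open>f\<close>: the former is the limit of \<open>\<langle>c m, c n\<rangle>\<close> in \<open>m\<close>, which differs
  from \<open>\<langle>c n, c n\<rangle>\<close> by at most \<open>\<parallel>c m - c n\<parallel> \<parallel>c n\<parallel>\<close>.
\<close>

lemma rkhs_limit_pairing_tendsto:
  assumes K: "psd_kernel T K" and lim: "rkhs_limit T K c f"
    and r: "(\<lambda>n. kernel_norm K (c n)) \<longlonglongrightarrow> r"
  shows "(\<lambda>n. pairing (c n) f) \<longlonglongrightarrow> r\<^sup>2"
proof -
  have keys: "\<And>n. Poly_Mapping.keys (c n) \<subseteq> T" using lim by (simp add: rkhs_limit_def)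
  have "Bseq (\<lambda>n. kernel_norm K (c n))" using r convergent_def convergent_imp_Bseq by blast
  then obtain B where B: "B > 0" "\<And>n. kernel_norm K (c n) \<le> B"
    unfolding Bseq_def by (metis abs_le_D1 real_norm_def)
  have "(\<lambda>n. pairing (c n) f - (kernel_norm K (c n))\<^sup>2) \<longlonglongrightarrow> 0"
  proof (rule LIMSEQ_I)
    fix e :: real assume "e > 0"
    then have "e / (2 * B) > 0" using B by simp
    then obtain N where N: "\<And>m n. m \<ge> N \<Longrightarrow> n \<ge> N \<Longrightarrow> kernel_norm K (c m - c n) < e / (2 * B)"
      using lim unfolding rkhs_limit_def by blast
    have "\<bar>pairing (c n) f - (kernel_norm K (c n))\<^sup>2\<bar> \<le> e / 2" if n: "n \<ge> N" for n
    proof (rule LIMSEQ_le_const2)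
      show "(\<lambda>m. \<bar>kernel_inner K (c m) (c n) - (kernel_norm K (c n))\<^sup>2\<bar>)
          \<longlonglongrightarrow> \<bar>pairing (c n) f - (kernel_norm K (c n))\<^sup>2\<bar>"
        by (intro tendsto_intros rkhs_limit_inner_tendsto[OF lim keys])
      have "\<bar>kernel_inner K (c m) (c n) - (kernel_norm K (c n))\<^sup>2\<bar> \<le> e / 2" if m: "m \<ge> N" for m
      proof -
        have "kernel_inner K (c m) (c n) - (kernel_norm K (c n))\<^sup>2 = kernel_inner K (c m - c n) (c n)"
          by (simp add: kernel_norm_square[OF K keys] kernel_inner_linear)
        then have "\<bar>kernel_inner K (c m) (c n) - (kernel_norm K (c n))\<^sup>2\<bar>
            \<le> kernel_norm K (c m - c n) * kernel_norm K (c n)"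
          using kernel_Cauchy_Schwarz[OF K keys_diff_subset[OF keys keys] keys] by metis
        also have "\<dots> \<le> e / (2 * B) * B"
          using N[OF m n] B \<open>e > 0\<close> kernel_norm_nonneg[OF K keys]
          by (intro mult_mono) (auto intro: less_imp_le)
        finally show ?thesis using B by simp
      qed
      then show "\<exists>N. \<forall>m\<ge>N. \<bar>kernel_inner K (c m) (c n) - (kernel_norm K (c n))\<^sup>2\<bar> \<le> e / 2" by blast
    qed
    then show "\<exists>N. \<forall>n\<ge>N. norm (pairing (c n) f - (kernel_norm K (c n))\<^sup>2 - 0) < e"
      using \<open>e > 0\<close> by (intro exI[of _ N] allI impI) fastforce
  qed
  from tendsto_add[OF this tendsto_power[OF r, of 2]] show ?thesis by simp
qed

text \<open>
  Pairing with \<open>f\<close> is bounded by the factor \<open>r\<close> on the second sequence, while it grows like the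
  square of the norm there: \<open>r'\<^sup>2 \<le> r r'\<close>. By symmetry the norm of \<open>f\<close> is independent of the
  approximating sequence.
\<close>

lemma rkhs_limit_norm_le:
  assumes K: "psd_kernel T K"
    and lim: "rkhs_limit T K c f" "(\<lambda>n. kernel_norm K (c n)) \<longlonglongrightarrow> r"
    and lim': "rkhs_limit T K c' f" "(\<lambda>n. kernel_norm K (c' n)) \<longlonglongrightarrow> r'"
  shows "r' \<le> r"
proof -
  have keys: "\<And>n. Poly_Mapping.keys (c n) \<subseteq> T" "\<And>n. Poly_Mapping.keys (c' n) \<subseteq> T"
    using lim lim' by (simp_all add: rkhs_limit_def)
  have "r'\<^sup>2 \<le> r * r'"
  proof (rule LIMSEQ_le)
    show "(\<lambda>n. pairing (c' n) f) \<longlonglongrightarrow> r'\<^sup>2" by (rule rkhs_limit_pairing_tendsto[OF K lim'])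
    show "(\<lambda>n. r * kernel_norm K (c' n)) \<longlonglongrightarrow> r * r'" by (intro tendsto_intros lim')
    show "\<exists>N. \<forall>n\<ge>N. pairing (c' n) f \<le> r * kernel_norm K (c' n)"
      using rkhs_limit_pairing_bound[OF K lim keys(2)] abs_le_D1 by blast
  qed
  moreover have "0 \<le> r" "0 \<le> r'"
    using lim(2) lim'(2) keys kernel_norm_nonneg[OF K] by (auto intro!: LIMSEQ_le_const)
  ultimately show ?thesis by (cases "r' = 0") (auto simp: power2_eq_square)
qed

lemma rkhs_norm_eq:
  assumes K: "psd_kernel T K"
    and "rkhs_limit T K c f" "(\<lambda>n. kernel_norm K (c n)) \<longlonglongrightarrow> r"
  shows "rkhs_norm T K f = r"
  unfolding rkhs_norm_def using assms rkhs_limit_norm_le[OF K]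
  by (intro the_equality) (blast intro: antisym)+

text \<open>
  The exact minimizer of \<open>\<Phi> d = \<langle>d, d\<rangle> - 2 pairing d f\<close> would represent the functional \<open>d \<mapsto> pairing d f\<close>
  but lives in the completion only. If \<open>\<Phi>\<close> is within \<open>\<epsilon>\<close> of its infimum at \<open>c\<close>, then along
  each line through \<open>c\<close> it is a quadratic polynomial that is at least the infimum, and the
  discriminant bounds the defect of \<open>c\<close> in direction \<open>d\<close> by \<open>\<surd>\<epsilon> \<parallel>d\<parallel>\<close>.
\<close>

lemma riesz_minimizing_sequence:
  assumes K: "psd_kernel T K"
    and bound: "\<And>d. Poly_Mapping.keys d \<subseteq> T \<Longrightarrow> (pairing d f)\<^sup>2 \<le> kernel_inner K d d"
  obtains c e where "\<And>n. Poly_Mapping.keys (c n) \<subseteq> T" "e \<longlonglongrightarrow> 0" "\<And>n. 0 \<le> e n"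
    "\<And>n d. Poly_Mapping.keys d \<subseteq> T \<Longrightarrow>
       \<bar>kernel_inner K (c n) d - pairing d f\<bar> \<le> e n * kernel_norm K d"
proof -
  define \<Phi> where "\<Phi> d = kernel_inner K d d - 2 * pairing d f" for d :: "'a \<Rightarrow>\<^sub>0 real"
  define D where "D = {d :: 'a \<Rightarrow>\<^sub>0 real. Poly_Mapping.keys d \<subseteq> T}"
  have lower: "-1 \<le> \<Phi> d" if "d \<in> D" for d
  proof -
    have "0 \<le> (pairing d f - 1)\<^sup>2" by simp
    then show ?thesis using bound[of d] that by (simp add: \<Phi>_def D_def power2_diff)
  qed
  then have bdd: "bdd_below (\<Phi> ` D)" by (auto intro!: bdd_belowI2)
  have "0 \<in> D" by (simp add: D_def)
  define m where "m = Inf (\<Phi> ` D)"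
  have "\<exists>c\<in>D. \<Phi> c < m + 1 / (real n + 1)" for n
    using cInf_lessD[of "\<Phi> ` D" "m + 1 / (real n + 1)"] \<open>0 \<in> D\<close> unfolding m_def by auto
  then obtain c where c: "\<And>n. c n \<in> D" "\<And>n. \<Phi> (c n) < m + 1 / (real n + 1)" by metis
  show ?thesis
  proof (rule that)
    show keys: "Poly_Mapping.keys (c n) \<subseteq> T" for n using c by (simp add: D_def)
    show "(\<lambda>n. sqrt (1 / (real n + 1))) \<longlonglongrightarrow> 0"
      using LIMSEQ_inverse_real_of_nat tendsto_real_sqrt by (fastforce simp: inverse_eq_divide add_ac)
    show "0 \<le> sqrt (1 / (real n + 1))" for n by simp
    fix n and d :: "'a \<Rightarrow>\<^sub>0 real" assume d: "Poly_Mapping.keys d \<subseteq> T"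
    have "(kernel_inner K (c n) d - pairing d f)\<^sup>2 \<le> (1 / (real n + 1)) * kernel_inner K d d"
    proof (rule nonneg_quadratic_discriminant)
      show "0 \<le> kernel_inner K d d" using K d by (simp add: psd_kernel_def)
      fix r
      have "m \<le> \<Phi> (c n + smult_pm r d)"
        unfolding m_def using keys_add_smult_subset[OF keys d] bdd
        by (intro cInf_lower) (auto simp: D_def)
      also have "\<dots> = \<Phi> (c n) + 2 * r * (kernel_inner K (c n) d - pairing d f) + r\<^sup>2 * kernel_inner K d d"
        unfolding \<Phi>_def kernel_inner_line[OF K keys d]
        by (simp add: pairing_add pairing_smult algebra_simps)
      finally show "0 \<le> 1 / (real n + 1) + 2 * r * (kernel_inner K (c n) d - pairing d f)
          + r\<^sup>2 * kernel_inner K d d"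
        using c(2)[of n] by linarith
    qed
    then have "sqrt ((kernel_inner K (c n) d - pairing d f)\<^sup>2)
        \<le> sqrt ((1 / (real n + 1)) * kernel_inner K d d)"
      by (rule real_sqrt_le_mono)
    then show "\<bar>kernel_inner K (c n) d - pairing d f\<bar> \<le> sqrt (1 / (real n + 1)) * kernel_norm K d"
      unfolding kernel_norm_def real_sqrt_mult by simp
  qed
qed

text \<open>
  Membership is expressed through the quadratic form of \<open>K\<close> alone, so the unit balls of different
  kernels become comparable although their completions are built from different sequences.
\<close>

theorem rkhs_unit_ball_iff:
  assumes K: "psd_kernel T K"
  shows "f \<in> rkhs_unit_ball T K \<longleftrightarrow> (\<forall>t. t \<notin> T \<longrightarrow> f t = 0) \<and>
    (\<forall>d. Poly_Mapping.keys d \<subseteq> T \<longrightarrow> (pairing d f)\<^sup>2 \<le> kernel_inner K d d)"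
proof (intro iffI conjI)
  assume f: "f \<in> rkhs_unit_ball T K"
  then obtain c where lim: "rkhs_limit T K c f" by (auto simp: rkhs_unit_ball_def rkhs_def)
  obtain r where r: "(\<lambda>n. kernel_norm K (c n)) \<longlonglongrightarrow> r" by (rule rkhs_limit_norm_convergent[OF K lim])
  have "r \<le> 1" using f rkhs_norm_eq[OF K lim r] by (simp add: rkhs_unit_ball_def)
  show "\<forall>t. t \<notin> T \<longrightarrow> f t = 0" using lim by (simp add: rkhs_limit_def)
  show "\<forall>d. Poly_Mapping.keys d \<subseteq> T \<longrightarrow> (pairing d f)\<^sup>2 \<le> kernel_inner K d d"
  proof (intro allI impI)
    fix d :: "'a \<Rightarrow>\<^sub>0 real" assume d: "Poly_Mapping.keys d \<subseteq> T"
    have "\<bar>pairing d f\<bar> \<le> r * kernel_norm K d" by (rule rkhs_limit_pairing_bound[OF K lim r d])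
    also have "\<dots> \<le> kernel_norm K d"
      using mult_right_mono[OF \<open>r \<le> 1\<close> kernel_norm_nonneg[OF K d]] by simp
    finally have "\<bar>pairing d f\<bar>\<^sup>2 \<le> (kernel_norm K d)\<^sup>2" by (intro power_mono) auto
    then show "(pairing d f)\<^sup>2 \<le> kernel_inner K d d" by (simp add: kernel_norm_square[OF K d])
  qed
next
  assume f: "(\<forall>t. t \<notin> T \<longrightarrow> f t = 0) \<and>
    (\<forall>d. Poly_Mapping.keys d \<subseteq> T \<longrightarrow> (pairing d f)\<^sup>2 \<le> kernel_inner K d d)"
  then have bound: "\<And>d. Poly_Mapping.keys d \<subseteq> T \<Longrightarrow> (pairing d f)\<^sup>2 \<le> kernel_inner K d d" by blast
  obtain c e where keys: "\<And>n. Poly_Mapping.keys (c n) \<subseteq> T" and e: "e \<longlonglongrightarrow> 0" "\<And>n. 0 \<le> e n"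
    and ce: "\<And>n d. Poly_Mapping.keys d \<subseteq> T \<Longrightarrow>
       \<bar>kernel_inner K (c n) d - pairing d f\<bar> \<le> e n * kernel_norm K d"
    using riesz_minimizing_sequence[OF K bound] by blast
  \<comment> \<open>Test the approximate representation by \<open>c m\<close> and by \<open>c n\<close> against their own difference;
    the functional cancels.\<close>
  have diff: "kernel_norm K (c m - c n) \<le> e m + e n" for m n
  proof -
    define d where "d = c m - c n"
    have d: "Poly_Mapping.keys d \<subseteq> T" unfolding d_def by (rule keys_diff_subset[OF keys keys])
    have "(kernel_norm K d)\<^sup>2 = kernel_inner K (c m) d - kernel_inner K (c n) d"
      unfolding kernel_norm_square[OF K d] by (simp add: d_def kernel_inner_linear)
    also have "\<dots> \<le> (e m + e n) * kernel_norm K d"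
      using ce[OF d, of m] ce[OF d, of n] by (simp add: distrib_right)
    finally show ?thesis
      using kernel_norm_nonneg[OF K d] e(2)[of m] e(2)[of n] unfolding d_def[symmetric]
      by (cases "kernel_norm K d = 0") (auto simp: power2_eq_square)
  qed
  have lim: "rkhs_limit T K c f"
    unfolding rkhs_limit_def
  proof (intro conjI allI impI ballI)
    show "Poly_Mapping.keys (c n) \<subseteq> T" for n by (rule keys)
    show "f t = 0" if "t \<notin> T" for t using f that by blast
  next
    fix \<epsilon> :: real assume "\<epsilon> > 0"
    then obtain N where N: "\<And>n. n \<ge> N \<Longrightarrow> e n < \<epsilon> / 2"
      using order_tendstoD(2)[OF e(1), of "\<epsilon> / 2"] by (auto simp: eventually_sequentially)
    have "kernel_norm K (c m - c n) < \<epsilon>" if "m \<ge> N" "n \<ge> N" for m n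
      using diff[of m n] N[OF that(1)] N[OF that(2)] by linarith
    then show "\<exists>N. \<forall>m\<ge>N. \<forall>n\<ge>N. kernel_norm K (c m - c n) < \<epsilon>" by blast
  next
    \<comment> \<open>Point evaluation at \<open>t\<close> is the pairing with a unit point mass.\<close>
    fix t assume "t \<in> T"
    then have \<delta>: "Poly_Mapping.keys (Poly_Mapping.single t (1::real)) \<subseteq> T" by simp
    have "(\<lambda>n. kernel_inner K (c n) (Poly_Mapping.single t 1)
        - pairing (Poly_Mapping.single t 1) f) \<longlonglongrightarrow> 0"
    proof (rule Lim_null_comparison)
      show "\<forall>\<^sub>F n in sequentially. norm (kernel_inner K (c n) (Poly_Mapping.single t 1)
          - pairing (Poly_Mapping.single t 1) f) \<le> e n * kernel_norm K (Poly_Mapping.single t 1)"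
        using ce[OF \<delta>] by simp
      show "(\<lambda>n. e n * kernel_norm K (Poly_Mapping.single t 1)) \<longlonglongrightarrow> 0"
        using tendsto_mult_right[OF e(1)] by simp
    qed
    then have "(\<lambda>n. kernel_comb K (c n) t - f t) \<longlonglongrightarrow> 0"
      by (simp only: kernel_inner_eq_pairing_comb pairing_single)
    then show "(\<lambda>n. kernel_comb K (c n) t) \<longlonglongrightarrow> f t" by (rule LIM_zero_cancel)
  qed
  obtain r where r: "(\<lambda>n. kernel_norm K (c n)) \<longlonglongrightarrow> r" by (rule rkhs_limit_norm_convergent[OF K lim])
  \<comment> \<open>Testing \<open>c n\<close> against itself compares its squared norm with the functional.\<close>
  have "kernel_norm K (c n) \<le> 1 + e n" for n
  proof -
    have "\<bar>pairing (c n) f\<bar> \<le> kernel_norm K (c n)"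
      using bound[OF keys] kernel_norm_nonneg[OF K keys]
      by (simp add: kernel_norm_def real_le_rsqrt)
    then have "(kernel_norm K (c n))\<^sup>2 \<le> (1 + e n) * kernel_norm K (c n)"
      using ce[OF keys, of n n] by (simp add: kernel_norm_square[OF K keys] distrib_right)
    then show ?thesis
      using kernel_norm_nonneg[OF K keys, of n] e(2)[of n]
      by (cases "kernel_norm K (c n) = 0") (auto simp: power2_eq_square)
  qed
  then have "r \<le> 1 + 0"
    using r e(1) by (intro LIMSEQ_le[OF r tendsto_add[OF tendsto_const e(1)]]) auto
  then show "f \<in> rkhs_unit_ball T K"
    using lim rkhs_norm_eq[OF K lim r] by (auto simp: rkhs_unit_ball_def rkhs_def)
qed

section \<open>Bessel--Clifford functions\<close>

text \<open>
  The Bessel--Clifford functions \<open>C\<^sub>k\<close>, related to the modified Bessel functions by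
  \<open>I\<^sub>k (2 q) = q ^ k * C\<^sub>k (q\<^sup>2)\<close>. In contrast to the latter they satisfy \<open>C\<^sub>k' = C\<^sub>k\<^sub>+\<^sub>1\<close> without
  further terms.
\<close>

definition bessel_clifford :: "nat \<Rightarrow> real \<Rightarrow> real" where
  "bessel_clifford k y = suminf (\<lambda>m. y ^ m / (fact m * fact (m + k)))"

lemma bessel_clifford_summable_norm: "summable (\<lambda>m. norm (y ^ m / (fact m * fact (m + k)) :: real))"
proof (rule summable_comparison_test')
  show "summable (\<lambda>m. \<bar>y\<bar> ^ m /\<^sub>R fact m)" by (rule summable_exp_generic)
  fix m :: nat assume "m \<ge> 0"
  have "(fact m :: real) * 1 \<le> fact m * fact (m + k)" by (intro mult_left_mono) auto
  then have "\<bar>y\<bar> ^ m / (fact m * fact (m + k)) \<le> \<bar>y\<bar> ^ m / fact m"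
    by (intro divide_left_mono) auto
  then show "norm (norm (y ^ m / (fact m * fact (m + k)) :: real)) \<le> \<bar>y\<bar> ^ m /\<^sub>R fact m"
    by (simp add: power_abs abs_mult divide_inverse mult_ac)
qed

lemma bessel_clifford_summable: "summable (\<lambda>m. y ^ m / (fact m * fact (m + k)) :: real)"
  using bessel_clifford_summable_norm by (rule summable_norm_cancel)

lemma bessel_clifford_sums: "(\<lambda>m. y ^ m / (fact m * fact (m + k))) sums bessel_clifford k y"
  unfolding bessel_clifford_def using bessel_clifford_summable by (rule summable_sums)

lemma bessel_clifford_has_sum:
  "((\<lambda>m. y ^ m / (fact m * fact (m + k))) has_sum bessel_clifford k y) UNIV"
  using bessel_clifford_summable_norm bessel_clifford_sums by (rule norm_summable_imp_has_sum)

lemma bessel_clifford_mono: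
  assumes "0 \<le> x" "x \<le> y"
  shows "bessel_clifford k x \<le> bessel_clifford k y"
  unfolding bessel_clifford_def
  by (intro suminf_le bessel_clifford_summable divide_right_mono power_mono assms) auto

lemma bessel_clifford_pos:
  assumes "0 \<le> y"
  shows "0 < bessel_clifford k y"
proof -
  have "(0::real) < 1 / fact k" by simp
  also have "1 / fact k = bessel_clifford k 0"
    using bessel_clifford_sums[of 0 k] powser_sums_zero[of "\<lambda>m. 1 / (fact m * fact (m + k)) :: real"]
    by (intro sums_unique2[OF _ bessel_clifford_sums]) (auto simp: mult_ac)
  also have "\<dots> \<le> bessel_clifford k y" by (intro bessel_clifford_mono) (use assms in auto)
  finally show ?thesis .
qed

lemma bessel_clifford_deriv [derivative_intros]:
  "(bessel_clifford k has_real_derivative bessel_clifford (Suc k) y) (at y)"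
proof -
  define c where "c m = (1 / (fact m * fact (m + k)) :: real)" for m
  have "((\<lambda>x. suminf (\<lambda>m. c m * x ^ m)) has_real_derivative suminf (\<lambda>m. diffs c m * y ^ m)) (at y)"
    by (rule termdiffs_strong_converges_everywhere)
      (use bessel_clifford_summable in \<open>simp add: c_def\<close>)
  moreover have "diffs c m * y ^ m = y ^ m / (fact m * fact (m + Suc k))" for m
    by (simp add: diffs_def c_def field_simps del: of_nat_Suc)
  ultimately show ?thesis
    by (simp add: c_def bessel_clifford_def[abs_def])
qed

lemma bessel_clifford_recurrence:
  "bessel_clifford k y = real (k + 1) * bessel_clifford (k + 1) y + y * bessel_clifford (k + 2) y"
proof (rule sums_unique2[OF bessel_clifford_sums])
  have "(\<lambda>m. y * (y ^ m / (fact m * fact (m + (k + 2))))) sums (y * bessel_clifford (k + 2) y)"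
    by (intro sums_mult bessel_clifford_sums)
  moreover have "y * (y ^ m / (fact m * H)) = real (Suc m) * y ^ Suc m / (fact (Suc m) * H)" for m H
    by (simp add: fact_Suc mult.assoc del: of_nat_Suc)
  then have "(\<lambda>m. y * (y ^ m / (fact m * fact (m + (k + 2))))) =
      (\<lambda>m. real (Suc m) * y ^ Suc m / (fact (Suc m) * fact (Suc m + (k + 1))))"
    by (metis (no_types) add_Suc_shift Suc_eq_plus1 add_2_eq_Suc')
  ultimately have "(\<lambda>m. real (Suc m) * y ^ Suc m / (fact (Suc m) * fact (Suc m + (k + 1))))
      sums (y * bessel_clifford (k + 2) y)" by simp
  then have "(\<lambda>m. real m * y ^ m / (fact m * fact (m + (k + 1)))) sums (y * bessel_clifford (k + 2) y)"
    by (subst (asm) sums_Suc_iff) simp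
  then have "(\<lambda>m. real (k + 1) * (y ^ m / (fact m * fact (m + (k + 1))))
        + real m * y ^ m / (fact m * fact (m + (k + 1))))
      sums (real (k + 1) * bessel_clifford (k + 1) y + y * bessel_clifford (k + 2) y)"
    by (intro sums_add sums_mult bessel_clifford_sums)
  moreover have "real (k + 1) * (y ^ m / (fact m * fact (m + (k + 1))))
        + real m * y ^ m / (fact m * fact (m + (k + 1))) = y ^ m / (fact m * fact (m + k))" for m
    by (simp add: divide_simps) (simp add: algebra_simps)
  ultimately show "(\<lambda>m. y ^ m / (fact m * fact (m + k)))
      sums (real (k + 1) * bessel_clifford (k + 1) y + y * bessel_clifford (k + 2) y)"
    by simp
qed

text \<open>
  This is \<open>I\<^sub>k\<^sub>+\<^sub>1 (2 q) \<le> I\<^sub>k (2 q)\<close>. Up to a factor in \<open>k\<close> and \<open>m\<close> that favours the claim, the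
  \<open>m\<close>-th term on the left is the geometric mean of the terms \<open>m\<close> and \<open>m + 1\<close> on the right, so
  twice the left series is at most twice the right one.
\<close>

lemma bessel_clifford_order_step:
  "q * bessel_clifford (Suc k) (q\<^sup>2) \<le> bessel_clifford k (q\<^sup>2)"
proof -
  define t where "t m = (q\<^sup>2) ^ m / (fact m * fact (m + k))" for m
  have t: "t sums bessel_clifford k (q\<^sup>2)" unfolding t_def by (rule bessel_clifford_sums)
  have tS: "(\<lambda>m. t (Suc m)) sums (bessel_clifford k (q\<^sup>2) - t 0)"
    using t by (simp add: sums_Suc_iff)
  have "2 * (q * bessel_clifford (Suc k) (q\<^sup>2)) \<le> bessel_clifford k (q\<^sup>2) + (bessel_clifford k (q\<^sup>2) - t 0)"
  proof (rule sums_le)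
    show "(\<lambda>m. 2 * (q * ((q\<^sup>2) ^ m / (fact m * fact (m + Suc k))))) sums (2 * (q * bessel_clifford (Suc k) (q\<^sup>2)))"
      by (intro sums_mult bessel_clifford_sums)
    show "(\<lambda>m. t m + t (Suc m)) sums (bessel_clifford k (q\<^sup>2) + (bessel_clifford k (q\<^sup>2) - t 0))"
      by (intro sums_add t tS)
    fix m
    \<comment> \<open>The AM-GM inequality \<open>2 x \<le> 1 + x\<^sup>2\<close> at \<open>x = q / B\<close>; the gap between \<open>A\<close> and \<open>B\<close>
      only helps.\<close>
    define A B where "A = real (m + 1)" and "B = real (m + k + 1)"
    have AB: "0 < A" "A \<le> B" by (simp_all add: A_def B_def)
    have "2 * (q / B) \<le> 1 + (q / B)\<^sup>2"
      using sum_squares_bound[of "q / B" 1] by simp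
    also have "(q / B)\<^sup>2 \<le> q\<^sup>2 / (A * B)"
      using AB mult_left_mono[OF AB(2), of "q * q"] by (simp add: power2_eq_square divide_simps mult_ac)
    finally have "t m * (2 * (q / B)) \<le> t m * (1 + q\<^sup>2 / (A * B))"
      by (intro mult_left_mono) (auto simp: t_def)
    also have "t (Suc m) = t m * (q\<^sup>2 / (A * B))"
    proof -
      have "fact (Suc m) = A * fact m" "fact (Suc m + k) = B * fact (m + k)"
        by (simp_all add: A_def B_def algebra_simps)
      then show ?thesis unfolding t_def by (simp add: mult_ac)
    qed
    then have "t m * (1 + q\<^sup>2 / (A * B)) = t m + t (Suc m)" by (simp add: distrib_left)
    also have "t m * (2 * (q / B)) = 2 * (q * ((q\<^sup>2) ^ m / (fact m * fact (m + Suc k))))"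
    proof -
      have "fact (m + Suc k) = B * fact (m + k)" by (simp add: B_def algebra_simps)
      then show ?thesis unfolding t_def by (simp add: mult_ac)
    qed
    finally show "2 * (q * ((q\<^sup>2) ^ m / (fact m * fact (m + Suc k)))) \<le> t m + t (Suc m)" .
  qed
  moreover have "0 \<le> t 0" by (simp add: t_def)
  ultimately show ?thesis by linarith
qed

section \<open>Spectral weights as functions of the inverse scale\<close>

text \<open>
  With \<open>x = 2 a\<^sup>2\<close> this is \<open>exp (-x) I\<^sub>k x\<close>, the \<open>k\<close>-th Fourier coefficient of \<open>G a\<close>.
\<close>

definition spectral_weight :: "nat \<Rightarrow> real \<Rightarrow> real" where
  "spectral_weight k a = exp (- 2 * a\<^sup>2) * a ^ (2 * k) * bessel_clifford k (a ^ 4)"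

lemma spectral_weight_nonneg: "0 \<le> spectral_weight k a"
  using bessel_clifford_pos[of "a ^ 4" k] by (simp add: spectral_weight_def)

text \<open>
  The expression has the sign of the derivative of \<open>exp (-x) w\<close> for \<open>w = \<surd>x I\<^sub>k x\<close> and \<open>x = 2 a\<^sup>2\<close>;
  that is, of \<open>w' - w\<close>. The function \<open>V\<close> below is \<open>exp x (w' - w)\<close> up to a constant factor. The
  assumption on \<open>k\<close> enters twice: it makes \<open>k\<^sup>2 - 1/4\<close> nonnegative and \<open>V\<close> vanish at \<open>0\<close>.
\<close>

lemma bessel_clifford_log_derivative_bound:
  fixes a :: real
  assumes "0 < a" "k \<ge> 1"
  shows "0 \<le> (k + 1/2 - 2 * a\<^sup>2) * bessel_clifford k (a ^ 4) + 2 * a ^ 4 * bessel_clifford (Suc k) (a ^ 4)"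
proof -
  \<comment> \<open>Writing \<open>k = j + 1\<close> keeps the exponents \<open>2 k - 1 = 2 j + 1\<close> and \<open>2 k - 2 = 2 j\<close> natural.\<close>
  obtain j where j: "k = Suc j" using assms(2) by (cases k) auto
  define v where "v x = (k + 1/2 - 2 * x\<^sup>2) * bessel_clifford k (x ^ 4)
    + 2 * x ^ 4 * bessel_clifford (Suc k) (x ^ 4)" for x :: real
  define V where "V x = exp (2 * x\<^sup>2) * x ^ (2 * j + 1) * v x" for x
  \<comment> \<open>\<open>V\<close> carries the integrating factor for which all terms of the derivative other than one
    multiple of \<open>C\<^sub>k\<close> cancel, once \<open>C\<^sub>k\<^sub>+\<^sub>2\<close> has been eliminated by the recurrence.\<close>
  have deriv: "(V has_real_derivative
      2 * exp (2 * x\<^sup>2) * x ^ (2 * j) * ((real k)\<^sup>2 - 1/4) * bessel_clifford k (x ^ 4)) (at x)" for x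
  proof -
    define h where "h i = bessel_clifford i (x ^ 4)" for i
    have D: "((\<lambda>x. bessel_clifford i (x ^ 4)) has_real_derivative h (Suc i) * (4 * x ^ 3)) (at x)" for i
      unfolding h_def by (rule DERIV_chain2[OF bessel_clifford_deriv]) (auto intro!: derivative_eq_intros)
    have rec: "h k = (k + 1) * h (Suc k) + x ^ 4 * h (Suc (Suc k))"
      unfolding h_def using bessel_clifford_recurrence[of k "x ^ 4"] by simp
    have "(V has_real_derivative
        exp (2 * x\<^sup>2) * (4 * x) * x ^ (2 * j + 1) * v x
        + exp (2 * x\<^sup>2) * ((2 * j + 1) * x ^ (2 * j)) * v x
        + exp (2 * x\<^sup>2) * x ^ (2 * j + 1) *
          ((- 4 * x) * h k + (k + 1/2 - 2 * x\<^sup>2) * (h (Suc k) * (4 * x ^ 3))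
            + (8 * x ^ 3) * h (Suc k) + 2 * x ^ 4 * (h (Suc (Suc k)) * (4 * x ^ 3)))) (at x)"
      unfolding V_def v_def
      by (rule derivative_eq_intros D refl | simp)+ (simp add: h_def algebra_simps)
    also have "exp (2 * x\<^sup>2) * (4 * x) * x ^ (2 * j + 1) * v x
        + exp (2 * x\<^sup>2) * ((2 * j + 1) * x ^ (2 * j)) * v x
        + exp (2 * x\<^sup>2) * x ^ (2 * j + 1) *
          ((- 4 * x) * h k + (k + 1/2 - 2 * x\<^sup>2) * (h (Suc k) * (4 * x ^ 3))
            + (8 * x ^ 3) * h (Suc k) + 2 * x ^ 4 * (h (Suc (Suc k)) * (4 * x ^ 3)))
      = exp (2 * x\<^sup>2) * x ^ (2 * j) * (4 * x\<^sup>2 * v x + (2 * j + 1) * v x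
        + (- 4 * x\<^sup>2) * h k + (k + 1/2 - 2 * x\<^sup>2) * (h (Suc k) * (4 * x ^ 4))
            + (8 * x ^ 4) * h (Suc k) + 8 * x ^ 4 * (x ^ 4 * h (Suc (Suc k))))"
      by (simp add: algebra_simps power2_eq_square power3_eq_cube power4_eq_xxxx)
    also have "x ^ 4 * h (Suc (Suc k)) = h k - (k + 1) * h (Suc k)" using rec by simp
    also have "v x = (k + 1/2 - 2 * x\<^sup>2) * h k + 2 * x ^ 4 * h (Suc k)" by (simp add: v_def h_def)
    also have "exp (2 * x\<^sup>2) * x ^ (2 * j) *
        (4 * x\<^sup>2 * ((k + 1/2 - 2 * x\<^sup>2) * h k + 2 * x ^ 4 * h (Suc k))
        + (2 * j + 1) * ((k + 1/2 - 2 * x\<^sup>2) * h k + 2 * x ^ 4 * h (Suc k))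
        + (- 4 * x\<^sup>2) * h k + (k + 1/2 - 2 * x\<^sup>2) * (h (Suc k) * (4 * x ^ 4))
            + (8 * x ^ 4) * h (Suc k) + 8 * x ^ 4 * (h k - (k + 1) * h (Suc k)))
      = 2 * exp (2 * x\<^sup>2) * x ^ (2 * j) * ((real k)\<^sup>2 - 1/4) * h k"
      unfolding j by (simp add: algebra_simps power2_eq_square power3_eq_cube power4_eq_xxxx)
    finally show ?thesis by (simp add: h_def)
  qed
  have "1 \<le> (real k)\<^sup>2" using assms(2) by simp
  then have k: "0 \<le> (real k)\<^sup>2 - 1/4" by simp
  have "V 0 \<le> V a"
  proof (rule DERIV_nonneg_imp_nondecreasing[where f = V])
    fix x :: real
    have "0 \<le> bessel_clifford k (x ^ 4)" using bessel_clifford_pos[of "x ^ 4" k] by simp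
    then show "\<exists>y. (V has_real_derivative y) (at x) \<and> 0 \<le> y"
      using k by (intro exI[of _ "2 * exp (2 * x\<^sup>2) * x ^ (2 * j) * ((real k)\<^sup>2 - 1/4) * bessel_clifford k (x ^ 4)"]
          conjI deriv) (auto simp: zero_le_mult_iff)
  qed (use assms in auto)
  then have "0 \<le> exp (2 * a\<^sup>2) * a ^ (2 * j + 1) * v a" by (simp add: V_def)
  moreover have "0 < exp (2 * a\<^sup>2) * a ^ (2 * j + 1)" using assms(1) by simp
  ultimately have "0 \<le> v a" by (meson linorder_not_less mult_pos_neg)
  then show ?thesis by (simp add: v_def)
qed

lemma scaled_spectral_weight_mono:
  assumes "0 < a" "a \<le> b" "k \<ge> 1"
  shows "a * spectral_weight k a \<le> b * spectral_weight k b"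
proof (rule DERIV_nonneg_imp_nondecreasing[OF assms(2)])
  fix x assume "a \<le> x" "x \<le> b"
  then have "x > 0" using assms by simp
  define h where "h i = bessel_clifford i (x ^ 4)" for i
  have D: "((\<lambda>x. bessel_clifford k (x ^ 4)) has_real_derivative h (Suc k) * (4 * x ^ 3)) (at x)"
    unfolding h_def by (rule DERIV_chain2[OF bessel_clifford_deriv]) (auto intro!: derivative_eq_intros)
  have "((\<lambda>x. exp (- 2 * x\<^sup>2) * x ^ (2 * k + 1) * bessel_clifford k (x ^ 4)) has_real_derivative
      2 * exp (- 2 * x\<^sup>2) * x ^ (2 * k) * ((k + 1/2 - 2 * x\<^sup>2) * h k + 2 * x ^ 4 * h (Suc k))) (at x)"
    by (rule derivative_eq_intros D refl | simp)+
      (simp add: h_def algebra_simps power2_eq_square power3_eq_cube power4_eq_xxxx)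
  moreover have "(\<lambda>x. exp (- 2 * x\<^sup>2) * x ^ (2 * k + 1) * bessel_clifford k (x ^ 4))
      = (\<lambda>x. x * spectral_weight k x)"
    by (simp add: spectral_weight_def fun_eq_iff mult_ac)
  moreover have "0 \<le> (k + 1/2 - 2 * x\<^sup>2) * h k + 2 * x ^ 4 * h (Suc k)"
    unfolding h_def by (rule bessel_clifford_log_derivative_bound[OF \<open>x > 0\<close> assms(3)])
  ultimately show "\<exists>y. ((\<lambda>x. x * spectral_weight k x) has_real_derivative y) (at x) \<and> 0 \<le> y"
    using \<open>x > 0\<close>
    by (intro exI[of _ "2 * exp (- 2 * x\<^sup>2) * x ^ (2 * k) * ((k + 1/2 - 2 * x\<^sup>2) * h k + 2 * x ^ 4 * h (Suc k))"]) auto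
qed

text \<open>
  On \<open>{0..1}\<close> the exponential factor of the weight lies between \<open>exp (-2)\<close> and \<open>1\<close>, and the
  remaining factor increases.
\<close>

lemma scaled_spectral_weight_zero_small:
  assumes "0 < a" "a \<le> b" "b \<le> 1"
  shows "a * spectral_weight 0 a \<le> exp 2 * (b * spectral_weight 0 b)"
proof -
  have "a * spectral_weight 0 a \<le> a * bessel_clifford 0 (a ^ 4)"
    using assms bessel_clifford_pos[of "a ^ 4" 0]
    by (intro mult_left_mono) (auto simp: spectral_weight_def)
  also have "\<dots> \<le> b * bessel_clifford 0 (b ^ 4)"
    using assms bessel_clifford_pos[of "a ^ 4" 0]
    by (intro mult_mono bessel_clifford_mono power_mono) auto
  also have "\<dots> = exp (2 * b\<^sup>2) * (b * spectral_weight 0 b)"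
    by (simp add: spectral_weight_def exp_minus field_simps)
  also have "\<dots> \<le> exp 2 * (b * spectral_weight 0 b)"
    using assms spectral_weight_nonneg[of 0 b] by (intro mult_right_mono) (auto simp: power_le_one)
  finally show ?thesis .
qed

text \<open>
  Away from the origin orders \<open>0\<close> and \<open>1\<close> are comparable, and order \<open>1\<close> is monotone: the weight
  of order \<open>0\<close> is at most \<open>1 + 1 / a\<^sup>2 \<le> 2\<close> times that of order \<open>1\<close> at \<open>a\<close>, and at least that of
  order \<open>1\<close> at \<open>b\<close>.
\<close>

lemma scaled_spectral_weight_zero_large:
  assumes "1 \<le> a" "a \<le> b"
  shows "a * spectral_weight 0 a \<le> 2 * (b * spectral_weight 0 b)"
proof -
  define C where "C i x = bessel_clifford i (x ^ 4)" for i and x :: real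
  have step: "x\<^sup>2 * C (Suc i) x \<le> C i x" for i x
    using bessel_clifford_order_step[of "x\<^sup>2" i] by (simp add: C_def flip: power_mult)
  have "C 0 a = C 1 a + a\<^sup>2 * (a\<^sup>2 * C 2 a)"
    using bessel_clifford_recurrence[of 0 "a ^ 4"] by (simp add: C_def numeral_2_eq_2 power4_eq_xxxx power2_eq_square)
  also have "\<dots> \<le> C 1 a + a\<^sup>2 * C 1 a"
    using step[of a 1] by (intro add_left_mono mult_left_mono) (auto simp: numeral_2_eq_2)
  also have "\<dots> \<le> a\<^sup>2 * C 1 a + a\<^sup>2 * C 1 a"
    using assms bessel_clifford_pos[of "a ^ 4" 1]
    by (intro add_right_mono) (auto simp: C_def mult_le_cancel_right1 one_le_power)
  finally have le: "C 0 a \<le> 2 * (a\<^sup>2 * C 1 a)" by (simp only: mult_2)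
  have "a * (exp (- 2 * a\<^sup>2) * C 0 a) \<le> a * (exp (- 2 * a\<^sup>2) * (2 * (a\<^sup>2 * C 1 a)))"
    using assms by (intro mult_left_mono le) auto
  moreover have "a * spectral_weight 0 a = a * (exp (- 2 * a\<^sup>2) * C 0 a)"
    "2 * (a * spectral_weight 1 a) = a * (exp (- 2 * a\<^sup>2) * (2 * (a\<^sup>2 * C 1 a)))"
    by (simp_all add: spectral_weight_def C_def)
  ultimately have "a * spectral_weight 0 a \<le> 2 * (a * spectral_weight 1 a)" by linarith
  also have "\<dots> \<le> 2 * (b * spectral_weight 1 b)"
    using scaled_spectral_weight_mono[of a b 1] assms by simp
  also have "\<dots> \<le> 2 * (b * spectral_weight 0 b)"
  proof -
    have "exp (- 2 * b\<^sup>2) * (b\<^sup>2 * C 1 b) \<le> exp (- 2 * b\<^sup>2) * C 0 b"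
      using step[of b 0] by (intro mult_left_mono) auto
    then show ?thesis using assms by (simp add: spectral_weight_def C_def mult_ac)
  qed
  finally show ?thesis .
qed

lemma scaled_spectral_weight_le:
  assumes "0 < a" "a \<le> b"
  shows "a * spectral_weight k a \<le> 2 * exp 2 * (b * spectral_weight k b)"
proof -
  have nonneg: "0 \<le> b * spectral_weight i b" for i
    using assms spectral_weight_nonneg[of i b] by simp
  have "1 \<le> exp (2::real)" by simp
  have e: "2 * (b * spectral_weight k b) \<le> 2 * exp 2 * (b * spectral_weight k b)"
    using nonneg[of k] by (intro mult_right_mono) auto
  \<comment> \<open>For order \<open>0\<close> the two partial bounds are chained through the point \<open>1\<close> when
    \<open>a \<le> 1 \<le> b\<close>; the product of their constants \<open>exp 2\<close> and \<open>2\<close> gives the constant.\<close>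
  consider "k \<ge> 1" | "k = 0" "b \<le> 1" | "k = 0" "1 \<le> a" | "k = 0" "a \<le> 1" "1 \<le> b" by linarith
  then show ?thesis
  proof cases
    case 1
    then show ?thesis using scaled_spectral_weight_mono[OF assms 1] e nonneg[of k] by linarith
  next
    case 2
    then show ?thesis
      using scaled_spectral_weight_zero_small[OF assms 2(2)] mult_nonneg_nonneg[OF exp_ge_zero[of 2] nonneg[of 0]]
      unfolding 2(1) by linarith
  next
    case 3
    then show ?thesis using scaled_spectral_weight_zero_large[OF _ assms(2)] e by fastforce
  next
    case 4
    have "a * spectral_weight 0 a \<le> exp 2 * (1 * spectral_weight 0 1)"
      using scaled_spectral_weight_zero_small[of a 1] assms 4 by simp
    also have "\<dots> \<le> exp 2 * (2 * (b * spectral_weight 0 b))"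
      using scaled_spectral_weight_zero_large[of 1 b] 4 by (intro mult_left_mono) auto
    finally show ?thesis using 4 by simp
  qed
qed

section \<open>Fourier expansion of the kernel\<close>

text \<open>
  The double series is summed unconditionally over all pairs, since the expansion below regroups
  it along the diagonals \<open>m - n\<close> instead of the antidiagonals of the Cauchy product.
\<close>

lemma exp_mult_has_sum:
  fixes z w :: complex
  shows "((\<lambda>(m, n). (z ^ m / fact m) * (w ^ n / fact n)) has_sum (exp z * exp w)) UNIV"
proof -
  have E: "((\<lambda>n. x ^ n / fact n) has_sum exp x) UNIV" for x :: complex
    using summable_norm_exp[of x] exp_converges[of x]
    by (intro norm_summable_imp_has_sum) (simp_all add: scaleR_conv_of_real field_simps)
  have R: "((\<lambda>n. x ^ n / fact n) has_sum exp x) UNIV" if "x \<ge> 0" for x :: real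
    using summable_norm_exp[of x] exp_converges[of x]
    by (intro norm_summable_imp_has_sum) (simp_all add: field_simps)
  have majorant: "(\<lambda>(m, n). (norm z ^ m / fact m) * (norm w ^ n / fact n)) summable_on Sigma UNIV (\<lambda>_. UNIV)"
  proof (rule summable_on_SigmaI)
    show "((\<lambda>n. case (m, n) of (m, n) \<Rightarrow> (norm z ^ m / fact m) * (norm w ^ n / fact n))
        has_sum (norm z ^ m / fact m) * exp (norm w)) UNIV" for m :: nat
      by (simp only: prod.case) (intro has_sum_cmult_right R norm_ge_zero)
    show "(\<lambda>m. (norm z ^ m / fact m) * exp (norm w)) summable_on UNIV"
      using has_sum_cmult_left[OF R[of "norm z"]] by (auto simp: summable_on_def)
  qed auto
  have norm_eq: "norm (case p of (m, n) \<Rightarrow> (z ^ m / fact m) * (w ^ n / fact n))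
      = (case p of (m, n) \<Rightarrow> (norm z ^ m / fact m) * (norm w ^ n / fact n))" for p :: "nat \<times> nat"
    by (cases p) (simp add: norm_mult norm_divide norm_power)
  have "(\<lambda>(m, n). (z ^ m / fact m) * (w ^ n / fact n)) summable_on Sigma UNIV (\<lambda>_. UNIV)"
    by (rule abs_summable_summable) (use majorant in \<open>simp only: norm_eq\<close>)
  then have "((\<lambda>(m, n). (z ^ m / fact m) * (w ^ n / fact n)) has_sum (exp z * exp w)) (Sigma UNIV (\<lambda>_. UNIV))"
  proof (rule has_sum_SigmaI[rotated 2])
    show "((\<lambda>n. case (m, n) of (m, n) \<Rightarrow> (z ^ m / fact m) * (w ^ n / fact n))
        has_sum (z ^ m / fact m) * exp w) UNIV" for m :: nat
      by (simp only: prod.case) (intro has_sum_cmult_right E)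
    show "((\<lambda>m. (z ^ m / fact m) * exp w) has_sum (exp z * exp w)) UNIV"
      by (intro has_sum_cmult_left E)
  qed
  then show ?thesis by (simp only: UNIV_Times_UNIV)
qed

text \<open>
  The Jacobi--Anger expansion of \<open>exp (2 q cos \<theta>) = exp z * exp (cnj z)\<close> for \<open>z = q * cis \<theta>\<close>.
\<close>

lemma exp_cos_fourier:
  fixes q \<theta> :: real
  shows "((\<lambda>k::int. q ^ nat \<bar>k\<bar> * bessel_clifford (nat \<bar>k\<bar>) (q\<^sup>2) * cos (of_int k * \<theta>))
    has_sum exp (2 * q * cos \<theta>)) UNIV"
proof -
  define z where "z = of_real q * cis \<theta>"
  have re_term: "Re ((z ^ m / fact m) * (cnj z ^ n / fact n))
      = q ^ (m + n) / (fact m * fact n) * cos (of_int (int m - int n) * \<theta>)" for m n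
  proof -
    have cis: "cis \<theta> ^ m * cis (- \<theta>) ^ n = cis (of_int (int m - int n) * \<theta>)"
      unfolding Complex.DeMoivre cis_mult by (simp add: algebra_simps)
    have "z ^ m * cnj z ^ n = of_real (q ^ (m + n)) * (cis \<theta> ^ m * cis (- \<theta>) ^ n)"
      by (simp add: z_def power_mult_distrib cis_cnj power_add)
    also note cis
    finally have "z ^ m * cnj z ^ n = of_real (q ^ (m + n)) * cis (of_int (int m - int n) * \<theta>)" .
    then have eq: "(z ^ m / fact m) * (cnj z ^ n / fact n)
        = of_real (q ^ (m + n) / (fact m * fact n)) * cis (of_int (int m - int n) * \<theta>)"
      by (simp add: field_simps)
    have "Re (of_real r * cis \<phi>) = r * cos \<phi>" for r \<phi> by simp
    then show ?thesis unfolding eq .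
  qed
  have "z + cnj z = of_real (2 * q * cos \<theta>)" unfolding complex_add_cnj by (simp add: z_def)
  then have prod: "exp z * exp (cnj z) = of_real (exp (2 * q * cos \<theta>))"
    by (metis exp_add exp_of_real)
  have "((\<lambda>(m, n). q ^ (m + n) / (fact m * fact n) * cos (of_int (int m - int n) * \<theta>))
      has_sum exp (2 * q * cos \<theta>)) UNIV"
    using has_sum_Re[OF exp_mult_has_sum[of z "cnj z"]] unfolding case_prod_unfold re_term prod Re_complex_of_real .
  \<comment> \<open>Collect the pairs \<open>(m, n)\<close> with common difference \<open>k = m - n\<close>; within such a family the
    pairs are numbered by \<open>j = min m n\<close>, and \<open>m + n = \<bar>k\<bar> + 2 j\<close>.\<close>
  also have "?this \<longleftrightarrow> ((\<lambda>(k, j). q ^ nat \<bar>k\<bar> * cos (of_int k * \<theta>)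
      * ((q\<^sup>2) ^ j / (fact j * fact (j + nat \<bar>k\<bar>)))) has_sum exp (2 * q * cos \<theta>)) (Sigma UNIV (\<lambda>_. UNIV))"
  proof (rule has_sum_reindex_bij_witness[where j = "\<lambda>(m, n). (int m - int n, min m n)"
        and i = "\<lambda>(k, j). (j + nat k, j + nat (- k))"])
    fix p :: "nat \<times> nat"
    have sq: "(q\<^sup>2) ^ i = q ^ i * q ^ i" for i by (simp add: power2_eq_square power_mult_distrib)
    obtain m n where p: "p = (m, n)" by (cases p)
    show "(case case p of (m, n) \<Rightarrow> (int m - int n, min m n) of (k, j) \<Rightarrow>
        q ^ nat \<bar>k\<bar> * cos (of_int k * \<theta>) * ((q\<^sup>2) ^ j / (fact j * fact (j + nat \<bar>k\<bar>))))
      = (case p of (m, n) \<Rightarrow> q ^ (m + n) / (fact m * fact n) * cos (of_int (int m - int n) * \<theta>))"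
    proof (cases "n \<le> m")
      case True
      then obtain d where "m = n + d" by (auto simp: le_iff_add)
      then show ?thesis by (simp add: p sq power_add mult_ac)
    next
      case False
      then obtain d where "n = m + d" by (metis le_iff_add nat_le_linear)
      then show ?thesis by (simp add: p sq power_add mult_ac)
    qed
  qed auto
  finally have "((\<lambda>k::int. q ^ nat \<bar>k\<bar> * cos (of_int k * \<theta>) * bessel_clifford (nat \<bar>k\<bar>) (q\<^sup>2))
      has_sum exp (2 * q * cos \<theta>)) UNIV"
    by (rule has_sum_Sigma'[where B = "\<lambda>_. UNIV"]) (simp only: prod.case, intro has_sum_cmult_right bessel_clifford_has_sum)
  then show ?thesis by (simp add: mult_ac)
qed

lemma G_fourier:
  "((\<lambda>k::int. spectral_weight (nat \<bar>k\<bar>) a * cos (of_int k * (2 * pi * (s - t)))) has_sum G a s t) UNIV"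
proof -
  have "G a s t = exp (- 2 * a\<^sup>2) * exp (2 * a\<^sup>2 * cos (2 * pi * (s - t)))"
  proof -
    have c: "cos (2 * pi * (s - t)) = 1 - 2 * (sin (pi * s - pi * t))\<^sup>2"
      using cos_double_sin[of "pi * s - pi * t"] by (simp add: algebra_simps)
    show ?thesis unfolding G_def c by (simp add: algebra_simps flip: exp_add)
  qed
  then show ?thesis
    using has_sum_cmult_right[OF exp_cos_fourier[of "a\<^sup>2" "2 * pi * (s - t)"], of "exp (- 2 * a\<^sup>2)"]
    by (simp add: spectral_weight_def mult_ac flip: power_mult)
qed

text \<open>
  The squared modulus of the \<open>k\<close>-th Fourier coefficient of the measure with point masses \<open>d s\<close> at \<open>s\<close>,
  in real form.
\<close>

definition trig_energy :: "(real \<Rightarrow>\<^sub>0 real) \<Rightarrow> int \<Rightarrow> real" where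
  "trig_energy d k =
     (\<Sum>s\<in>Poly_Mapping.keys d. Poly_Mapping.lookup d s * cos (of_int k * (2 * pi * s)))\<^sup>2 +
     (\<Sum>s\<in>Poly_Mapping.keys d. Poly_Mapping.lookup d s * sin (of_int k * (2 * pi * s)))\<^sup>2"

lemma has_sum_sum:
  fixes f :: "'i \<Rightarrow> 'k \<Rightarrow> real"
  assumes "\<And>i. i \<in> I \<Longrightarrow> (f i has_sum g i) A"
  shows "((\<lambda>k. \<Sum>i\<in>I. f i k) has_sum (\<Sum>i\<in>I. g i)) A"
  using assms by (induction I rule: infinite_finite_induct) (auto intro: has_sum_add)

text \<open>
  The Fourier expansion diagonalizes the quadratic forms of all kernels \<open>G a\<close> simultaneously:
  the energies do not depend on \<open>a\<close>, so the forms can be compared coefficient by coefficient.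
\<close>

lemma kernel_inner_G_fourier:
  "((\<lambda>k::int. spectral_weight (nat \<bar>k\<bar>) a * trig_energy d k) has_sum kernel_inner (G a) d d) UNIV"
proof -
  have "((\<lambda>k::int. \<Sum>s\<in>Poly_Mapping.keys d. \<Sum>t\<in>Poly_Mapping.keys d.
        Poly_Mapping.lookup d s * Poly_Mapping.lookup d t
          * (spectral_weight (nat \<bar>k\<bar>) a * cos (of_int k * (2 * pi * (s - t)))))
      has_sum kernel_inner (G a) d d) UNIV"
    unfolding kernel_inner_def by (intro has_sum_sum has_sum_cmult_right G_fourier)
  also have "(\<lambda>k::int. \<Sum>s\<in>Poly_Mapping.keys d. \<Sum>t\<in>Poly_Mapping.keys d.
        Poly_Mapping.lookup d s * Poly_Mapping.lookup d t
          * (spectral_weight (nat \<bar>k\<bar>) a * cos (of_int k * (2 * pi * (s - t)))))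
      = (\<lambda>k. spectral_weight (nat \<bar>k\<bar>) a * trig_energy d k)"
    by (simp add: fun_eq_iff trig_energy_def power2_eq_square sum_product right_diff_distrib cos_diff
        sum_distrib_left sum.distrib distrib_left mult_ac)
  finally show ?thesis .
qed

section \<open>Comparison of the unit balls\<close>

lemma trig_energy_nonneg: "0 \<le> trig_energy d k"
  by (simp add: trig_energy_def)

lemma psd_kernel_G: "psd_kernel T (G a)"
proof -
  have "G a s t = G a t s" for s t
    using sin_minus[of "pi * s - pi * t"] by (simp add: G_def)
  moreover have "0 \<le> kernel_inner (G a) d d" for d
    using kernel_inner_G_fourier[of a d]
    by (rule has_sum_nonneg) (simp add: spectral_weight_nonneg trig_energy_nonneg)
  ultimately show ?thesis by (auto simp: psd_kernel_def)
qed

lemma kernel_inner_G_le: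
  assumes "0 < a" "a \<le> b"
  shows "a * kernel_inner (G a) d d \<le> (2 * exp 2 * b) * kernel_inner (G b) d d"
proof (rule has_sum_mono[OF has_sum_cmult_right[OF kernel_inner_G_fourier]
      has_sum_cmult_right[OF kernel_inner_G_fourier]])
  fix k :: int
  have "a * spectral_weight (nat \<bar>k\<bar>) a * trig_energy d k
      \<le> 2 * exp 2 * (b * spectral_weight (nat \<bar>k\<bar>) b) * trig_energy d k"
    by (intro mult_right_mono scaled_spectral_weight_le assms trig_energy_nonneg)
  then show "a * (spectral_weight (nat \<bar>k\<bar>) a * trig_energy d k)
      \<le> (2 * exp 2 * b) * (spectral_weight (nat \<bar>k\<bar>) b * trig_energy d k)"
    by (simp only: mult_ac)
qed

text \<open>
  Rescaling \<open>f\<close> by \<open>\<surd>(a / c)\<close> turns the bound of its pairings by the form of \<open>K\<close> into one by the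
  form of \<open>L\<close>.
\<close>

lemma scaled_rkhs_unit_ball_mono:
  assumes K: "psd_kernel T K" and L: "psd_kernel T L" and pos: "0 < a" "0 < c"
    and le: "\<And>d. Poly_Mapping.keys d \<subseteq> T \<Longrightarrow> a * kernel_inner K d d \<le> c * kernel_inner L d d"
  shows "scale_set (sqrt a) (rkhs_unit_ball T K) \<subseteq> scale_set (sqrt c) (rkhs_unit_ball T L)"
proof
  fix g assume "g \<in> scale_set (sqrt a) (rkhs_unit_ball T K)"
  then obtain f where f: "f \<in> rkhs_unit_ball T K" and g: "g = (\<lambda>t. sqrt a * f t)"
    by (auto simp: scale_set_def)
  define h where "h = (\<lambda>t. sqrt (a / c) * f t)"
  have "h \<in> rkhs_unit_ball T L"
    unfolding rkhs_unit_ball_iff[OF L]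
  proof (intro conjI allI impI)
    show "h t = 0" if "t \<notin> T" for t
      using f that by (simp add: h_def rkhs_unit_ball_iff[OF K])
    fix d :: "'a \<Rightarrow>\<^sub>0 real" assume d: "Poly_Mapping.keys d \<subseteq> T"
    have "(pairing d h)\<^sup>2 = a / c * (pairing d f)\<^sup>2"
      using pos by (simp add: h_def pairing_scale_right power_mult_distrib)
    also have "\<dots> \<le> a / c * kernel_inner K d d"
      using f d pos by (intro mult_left_mono) (simp_all add: rkhs_unit_ball_iff[OF K])
    also have "\<dots> \<le> kernel_inner L d d"
      using le[OF d] pos by (simp add: field_simps)
    finally show "(pairing d h)\<^sup>2 \<le> kernel_inner L d d" .
  qed
  moreover have "g = (\<lambda>t. sqrt c * h t)"
    using pos by (simp add: g h_def real_sqrt_divide)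
  ultimately show "g \<in> scale_set (sqrt c) (rkhs_unit_ball T L)"
    by (auto simp: scale_set_def)
qed

text \<open>
  The covariance function of a process is prescribed on its index set only; the values elsewhere
  do not affect the unit ball, because the quadratic form never uses them.
\<close>

lemma rkhs_unit_ball_cong:
  assumes K: "psd_kernel T K" and eq: "\<And>s t. s \<in> T \<Longrightarrow> t \<in> T \<Longrightarrow> L s t = K s t"
  shows "rkhs_unit_ball T L = rkhs_unit_ball T K"
proof -
  have inner: "kernel_inner L d d = kernel_inner K d d" if "Poly_Mapping.keys d \<subseteq> T" for d
    unfolding kernel_inner_def using that eq by (intro sum.cong refl) (simp add: subset_iff)
  then have L: "psd_kernel T L" using K eq by (simp add: psd_kernel_def)
  show ?thesis
    using inner by (auto simp: rkhs_unit_ball_iff[OF K] rkhs_unit_ball_iff[OF L])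
qed

lemma process_rkhs_unit_ball_G:
  assumes "centered_gaussian_process M T W (G a)"
  shows "process_rkhs_unit_ball M T W = rkhs_unit_ball T (G a)"
  unfolding process_rkhs_unit_ball_def
  using assms by (intro rkhs_unit_ball_cong psd_kernel_G) (simp add: centered_gaussian_process_def)

theorem lemma4p7:
  "\<exists>c::real. c > 0 \<and> (\<forall>a b::real. 0 < a \<and> a \<le> b \<longrightarrow>
     scale_set (sqrt a) (rkhs_unit_ball {0..1} (G a))
       \<subseteq> scale_set (sqrt (c * b)) (rkhs_unit_ball {0..1} (G b)) \<and>
     (\<forall>(M :: 'w measure) W (N :: 'v measure) V.
        centered_gaussian_process M {0..1} W (G a) \<longrightarrow>
        centered_gaussian_process N {0..1} V (G b) \<longrightarrow>
        scale_set (sqrt a) (process_rkhs_unit_ball M {0..1} W)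
          \<subseteq> scale_set (sqrt (c * b)) (process_rkhs_unit_ball N {0..1} V)))"
proof (intro exI[of _ "2 * exp 2"] conjI allI impI)
  fix a b :: real
  assume "0 < a \<and> a \<le> b"
  then have ab: "0 < a" "a \<le> b" by simp_all
  show incl: "scale_set (sqrt a) (rkhs_unit_ball {0..1} (G a))
      \<subseteq> scale_set (sqrt (2 * exp 2 * b)) (rkhs_unit_ball {0..1} (G b))"
    using ab by (intro scaled_rkhs_unit_ball_mono psd_kernel_G kernel_inner_G_le) auto
  fix M :: "'w measure" and W and N :: "'v measure" and V
  assume "centered_gaussian_process M {0..1} W (G a)" "centered_gaussian_process N {0..1} V (G b)"
  then show "scale_set (sqrt a) (process_rkhs_unit_ball M {0..1} W)
      \<subseteq> scale_set (sqrt (2 * exp 2 * b)) (process_rkhs_unit_ball N {0..1} V)"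
    using incl by (simp add: process_rkhs_unit_ball_G)
qed simp

end
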